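(* Let $X$ be a real-valued random variable on a probability space $(\Omega,\mathcal{F},\mathbb{P})$. Suppose $\phi:\mathbb{R}\to[0,\infty)$ is a nonnegative, nondecreasing, Lebesgue-measurable function. Let $n\ge 1$. If $0<\lambda_1<\lambda_2<\cdots<\lambda_n<\lambda_{n+1}=\infty$ (with $\lambda_1,\dots,\lambda_n$ real), then $$\sum_{k=1}^{n}\phi(\lambda_k)\,\mathbb{P}(\lambda_k\le X<\lambda_{k+1})\le\mathbb{E}(\phi(X)).$$
   Context: $\mathbb{E}(\phi(X))=\int_\Omega \phi\circ X\,d\mathbb{P}\in[0,\infty]$ denotes the expectation of the nonnegative random variable $\phi(X)$. Since $\lambda_{n+1}=\infty$, the event in the $k=n$ term is $\{X\ge\lambda_n\}$. *)

theory Defs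
  imports "HOL-Probability.Probability"
begin

end

theory Submission
  imports Defs
begin

text \<open>
  The half-open intervals between consecutive thresholds are pairwise disjoint, and on the event
  that \<open>X\<close> lies in the interval starting at \<open>lam k\<close> monotonicity gives
  \<open>\<phi> (lam k) \<le> \<phi> (X \<omega>)\<close>. The sum is therefore the integral of a step function
  lying below \<open>\<phi> \<circ> X\<close>: at each point at most one summand is nonzero, and that summand
  is dominated. The lemma \<open>sum_emeasure_disjoint_le_nn_integral\<close> is this generalized Markov
  inequality for an arbitrary finite disjoint family, and \<open>disjoint_consecutive_intervals\<close>
  provides the family.
\<close>

text \<open>
  The left-hand side is the integral of the step function that takes the value \<open>c i\<close> on
  \<open>A i\<close> and vanishes elsewhere; disjointness keeps overlapping values from adding up, so this
  step function stays below \<open>f\<close>.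
\<close>
lemma sum_emeasure_disjoint_le_nn_integral:
  fixes c :: "'i \<Rightarrow> ennreal" and f :: "'a \<Rightarrow> ennreal"
  assumes "finite I"
    and disj: "disjoint_family_on A I"
    and meas: "\<And>i. i \<in> I \<Longrightarrow> A i \<in> sets M"
    and le: "\<And>i x. i \<in> I \<Longrightarrow> x \<in> A i \<Longrightarrow> c i \<le> f x"
  shows "(\<Sum>i\<in>I. c i * emeasure M (A i)) \<le> (\<integral>\<^sup>+ x. f x \<partial>M)"
proof -
  have pointwise: "(\<Sum>i\<in>I. c i * indicator (A i) x) \<le> f x" for x
  proof (cases "\<exists>j\<in>I. x \<in> A j")
    case True
    then obtain j where j: "j \<in> I" "x \<in> A j" by blast
    have "(\<Sum>i\<in>I. c i * indicator (A i) x) = c j"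
      by (rule sum_indicator_disjoint_family[OF disj j(2) \<open>finite I\<close> j(1)])
    then show ?thesis using le[OF j] by simp
  next
    case False
    then have "(\<Sum>i\<in>I. c i * indicator (A i) x) = 0"
      by (intro sum.neutral) auto
    then show ?thesis by simp
  qed
  have "(\<Sum>i\<in>I. c i * emeasure M (A i)) = (\<Sum>i\<in>I. \<integral>\<^sup>+ x. c i * indicator (A i) x \<partial>M)"
    by (intro sum.cong refl) (simp add: nn_integral_cmult_indicator meas)
  also have "\<dots> = (\<integral>\<^sup>+ x. (\<Sum>i\<in>I. c i * indicator (A i) x) \<partial>M)"
    by (intro nn_integral_sum[symmetric] borel_measurable_times_ennreal borel_measurable_const
        borel_measurable_indicator meas)
  also have "\<dots> \<le> (\<integral>\<^sup>+ x. f x \<partial>M)"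
    by (intro nn_integral_mono pointwise)
  finally show ?thesis .
qed

lemma disjoint_consecutive_intervals:
  fixes a :: "nat \<Rightarrow> 'b::linorder"
  assumes step: "\<And>k. k \<in> {m..n} \<Longrightarrow> a k \<le> a (Suc k)"
  shows "disjoint_family_on (\<lambda>k. {a k..<a (Suc k)}) {m..n}"
proof -
  have mono: "a i \<le> a j" if "m \<le> i" "i \<le> j" "j \<le> Suc n" for i j
    using that(2,3)
  proof (induction j rule: dec_induct)
    case base
    show ?case by simp
  next
    case (step j)
    then show ?case using assms[of j] \<open>m \<le> i\<close> by (auto intro: order_trans)
  qed
  have disj: "{a i..<a (Suc i)} \<inter> {a j..<a (Suc j)} = {}"
    if "i \<in> {m..n}" "j \<in> {m..n}" "i < j" for i j
    using mono[of "Suc i" j] that by (auto simp: not_less)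
  show ?thesis
    unfolding disjoint_family_on_def
    by (metis disj inf_commute linorder_neqE_nat)
qed

theorem theorem3p1:
  fixes M :: "'a measure" and X :: "'a \<Rightarrow> real" and \<phi> :: "real \<Rightarrow> real"
    and lam :: "nat \<Rightarrow> ereal" and n :: nat
  assumes "prob_space M"
    and "X \<in> borel_measurable M"
    and "\<And>x. 0 \<le> \<phi> x"
    and "mono \<phi>"
    and "\<phi> \<in> borel_measurable lebesgue"
    and "1 \<le> n"
    and "0 < lam 1"
    and "\<And>k. k \<in> {1..n} \<Longrightarrow> lam k < lam (k + 1)"
    and "\<And>k. k \<in> {1..n} \<Longrightarrow> \<bar>lam k\<bar> \<noteq> \<infinity>"
    and "lam (n + 1) = \<infinity>"
  shows "ennreal (\<Sum>k = 1..n. \<phi> (real_of_ereal (lam k)) *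
            \<P>(\<omega> in M. lam k \<le> ereal (X \<omega>) \<and> ereal (X \<omega>) < lam (k + 1)))
         \<le> (\<integral>\<^sup>+ \<omega>. ennreal (\<phi> (X \<omega>)) \<partial>M)"
proof -
  interpret prob_space M by fact
  note [measurable] = \<open>X \<in> borel_measurable M\<close>
  define A where
    "A k = {\<omega> \<in> space M. lam k \<le> ereal (X \<omega>) \<and> ereal (X \<omega>) < lam (k + 1)}" for k
  have meas: "A k \<in> sets M" for k
    unfolding A_def by measurable
  have "disjoint_family_on (\<lambda>k. {lam k..<lam (Suc k)}) {1..n}"
    using assms(8) by (intro disjoint_consecutive_intervals) (simp add: less_imp_le)
  then have disj: "disjoint_family_on A {1..n}"
    unfolding disjoint_family_on_def A_def by fastforce
  have le: "ennreal (\<phi> (real_of_ereal (lam k))) \<le> ennreal (\<phi> (X \<omega>))"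
    if "k \<in> {1..n}" "\<omega> \<in> A k" for k \<omega>
  proof -
    have "real_of_ereal (lam k) \<le> X \<omega>"
      using assms(9)[OF that(1)] that(2) by (cases "lam k") (auto simp: A_def)
    then show ?thesis
      by (intro ennreal_leI monoD[OF \<open>mono \<phi>\<close>])
  qed
  have "ennreal (\<Sum>k = 1..n. \<phi> (real_of_ereal (lam k)) * prob (A k))
      = (\<Sum>k = 1..n. ennreal (\<phi> (real_of_ereal (lam k))) * emeasure M (A k))"
    using assms(3) by (simp add: sum_ennreal[symmetric] ennreal_mult emeasure_eq_measure)
  also have "\<dots> \<le> (\<integral>\<^sup>+ \<omega>. ennreal (\<phi> (X \<omega>)) \<partial>M)"
    by (rule sum_emeasure_disjoint_le_nn_integral[OF _ disj meas le]) auto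
  finally show ?thesis unfolding A_def .
qed

end
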